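(* Let $L=S\times\mathbb{R}$ be a geodesically conformally asymptotically flat standard stationary spacetime. Then all the hypersurfaces $S^{n-1}(r_0)\times\mathbb{R}$ are strongly light-convex for any sphere $S^{n-1}(r_0)$ of large radius $r_0$ (i.e., with $r_0$ greater than some constant).
   Context: Standard stationary spacetime: $L=S\times\mathbb{R}$, $\dim S=n$, with $g_L\big((y,\tau),(y,\tau)\big)=g_0(y,y)+2\omega_0(y)\tau-\beta(x)\tau^2$ for $(y,\tau)\in T_xS\times\mathbb{R}$, with $g_0$ a Riemannian metric, $\omega_0$ a one-form, $\beta>0$ a function on $S$. Put $h(y,y)=\frac1{\beta^2}\omega_0(y)^2+\frac1\beta g_0(y,y)$ and $\omega=\frac1\beta\omega_0$. $L$ is geodesically conformally asymptotically flat if there is a compact set $K\subset S$ such that $S\setminus K$ is a disjoint union of ends $E^{(k)}$, $k=1,\dots,m$, each diffeomorphic to $\mathbb{R}^n\setminus\{0\}$ and admitting an asymptotic coordinate chart $x=(x^1,\dots,x^n)$ and constants $p,q>0$ with, as $|x|\to\infty$ ($|x|^2=\sum_i(x^i)^2$), $$h_{ij}=\delta_{ij}+O(1/|x|^p),\quad \partial_kh_{ij}=O(1/|x|^{p+1}),\quad \partial_i\omega_j-\partial_j\omega_i=O(1/|x|^{q+1}).$$ $S^{n-1}(r_0)$ is the sphere $|x|^2=r_0^2$ in the asymptotic coordinates of an end, regarded as the boundary of the region $|x|^2<r_0^2$. Strong light-convexity of $S^{n-1}(r_0)\times\mathbb{R}$ means: with $\Phi(x,t)=\phi(x)=r_0^2-|x|^2$,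 one has $H^{g_L}_\Phi(v,v)<0$ for every lightlike $v$ tangent to $S^{n-1}(r_0)\times\mathbb{R}$, where $H^{g_L}_\Phi$ is the Hessian for the Levi-Civita connection of $g_L$. *)

theory Defs
  imports "HOL-Analysis.Analysis" "HOL-Library.Landau_Symbols"
begin

subsection \<open>Smooth manifolds\<close>

text \<open>A chart is a pair of its domain and its coordinate map (irrelevant outside the domain).\<close>

type_synonym ('s, 'e) chart = "'s set \<times> ('s \<Rightarrow> 'e)"

definition in_coords :: "('s, 'e) chart \<Rightarrow> ('s \<Rightarrow> 'b) \<Rightarrow> 'e \<Rightarrow> 'b" where
  "in_coords c f = f \<circ> inv_into (fst c) (snd c)"

definition differential ::
    "('s, 'e::real_normed_vector) chart \<Rightarrow> ('s \<Rightarrow> 'b::real_normed_vector) \<Rightarrow> 's \<Rightarrow> 'e \<Rightarrow> 'b" where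
  "differential c f P = frechet_derivative (in_coords c f) (at (snd c P))"

text \<open>\<open>Ck_on k U f\<close> is meant for open \<open>U\<close>: all iterated directional derivatives of \<open>f\<close>
  of order less than \<open>k\<close> are differentiable on \<open>U\<close>, those of order \<open>k\<close> are continuous.\<close>

primrec Ck_on ::
    "nat \<Rightarrow> 'e::real_normed_vector set \<Rightarrow> ('e \<Rightarrow> 'b::real_normed_vector) \<Rightarrow> bool" where
  "Ck_on 0 U f \<longleftrightarrow> continuous_on U f"
| "Ck_on (Suc k) U f \<longleftrightarrow>
     f differentiable_on U \<and> (\<forall>v. Ck_on k U (\<lambda>z. frechet_derivative f (at z) v))"

definition smooth_on ::
    "'e::real_normed_vector set \<Rightarrow> ('e \<Rightarrow> 'b::real_normed_vector) \<Rightarrow> bool" where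
  "smooth_on U f \<longleftrightarrow> (\<forall>k. Ck_on k U f)"

definition is_chart :: "('s::topological_space, 'e::euclidean_space) chart \<Rightarrow> bool" where
  "is_chart c \<longleftrightarrow>
     open (fst c) \<and> open (snd c ` fst c) \<and> inj_on (snd c) (fst c) \<and>
     homeomorphism (fst c) (snd c ` fst c) (snd c) (inv_into (fst c) (snd c))"

definition compatible :: "('s, 'e::euclidean_space) chart \<Rightarrow> ('s, 'e) chart \<Rightarrow> bool" where
  "compatible c d \<longleftrightarrow>
     smooth_on (snd c ` (fst c \<inter> fst d)) (in_coords c (snd d)) \<and>
     smooth_on (snd d ` (fst c \<inter> fst d)) (in_coords d (snd c))"

text \<open>A smooth structure on the whole type \<open>'s\<close>, given by its maximal atlas.\<close>

definition smooth_manifold ::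
    "('s::{t2_space, second_countable_topology}, 'e::euclidean_space) chart set \<Rightarrow> bool" where
  "smooth_manifold A \<longleftrightarrow>
     (\<forall>c\<in>A. is_chart c) \<and>
     (\<Union>c\<in>A. fst c) = UNIV \<and>
     (\<forall>c\<in>A. \<forall>d\<in>A. compatible c d) \<and>
     (\<forall>c. is_chart c \<and> (\<forall>d\<in>A. compatible c d) \<longrightarrow> c \<in> A)"


subsection \<open>Tensor fields\<close>

text \<open>A tensor field assigns to every chart \<open>c\<close> and every point of its domain a multilinear form
  on the model space, namely the field expressed in the coordinates \<open>c\<close>. Under a change of
  chart the forms are related by the differential of the transition map.\<close>

type_synonym ('s, 'e) covector_field = "('s, 'e) chart \<Rightarrow> 's \<Rightarrow> 'e \<Rightarrow> real"
type_synonym ('s, 'e) bilinear_field = "('s, 'e) chart \<Rightarrow> 's \<Rightarrow> 'e \<Rightarrow> 'e \<Rightarrow> real"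

definition smooth_function ::
    "('s, 'e::euclidean_space) chart set \<Rightarrow> ('s \<Rightarrow> real) \<Rightarrow> bool" where
  "smooth_function A f \<longleftrightarrow> (\<forall>c\<in>A. smooth_on (snd c ` fst c) (in_coords c f))"

definition one_form ::
    "('s, 'e::euclidean_space) chart set \<Rightarrow> ('s, 'e) covector_field \<Rightarrow> bool" where
  "one_form A \<omega> \<longleftrightarrow>
     (\<forall>c\<in>A. \<forall>P\<in>fst c. linear (\<omega> c P)) \<and>
     (\<forall>c\<in>A. \<forall>v. smooth_on (snd c ` fst c) (in_coords c (\<lambda>P. \<omega> c P v))) \<and>
     (\<forall>c\<in>A. \<forall>d\<in>A. \<forall>P\<in>fst c \<inter> fst d. \<forall>v.
        \<omega> c P v = \<omega> d P (differential c (snd d) P v))"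

definition riemannian_metric ::
    "('s, 'e::euclidean_space) chart set \<Rightarrow> ('s, 'e) bilinear_field \<Rightarrow> bool" where
  "riemannian_metric A g \<longleftrightarrow>
     (\<forall>c\<in>A. \<forall>P\<in>fst c. bilinear (g c P) \<and> (\<forall>u v. g c P u v = g c P v u) \<and>
        (\<forall>v. v \<noteq> 0 \<longrightarrow> g c P v v > 0)) \<and>
     (\<forall>c\<in>A. \<forall>u v. smooth_on (snd c ` fst c) (in_coords c (\<lambda>P. g c P u v))) \<and>
     (\<forall>c\<in>A. \<forall>d\<in>A. \<forall>P\<in>fst c \<inter> fst d. \<forall>u v.
        g c P u v = g d P (differential c (snd d) P u) (differential c (snd d) P v))"


subsection \<open>Levi-Civita connection and Hessian\<close>

text \<open>Here \<open>g\<close> holds the components, in the fixed chart \<open>c\<close>, of a semi-Riemannian metric.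
  The Levi-Civita connection is represented at \<open>P\<close> by its Christoffel map
  \<open>\<Gamma> u v = \<nabla>\<^sub>u v\<close> for coordinate-constant fields \<open>u\<close>, \<open>v\<close>:
  the connection is symmetric and metric.\<close>

definition levi_civita ::
    "('s, 'e::euclidean_space) chart \<Rightarrow> ('s \<Rightarrow> 'e \<Rightarrow> 'e \<Rightarrow> real) \<Rightarrow> 's \<Rightarrow> 'e \<Rightarrow> 'e \<Rightarrow> 'e" where
  "levi_civita c g P = (THE \<Gamma>. bilinear \<Gamma> \<and> (\<forall>u v. \<Gamma> u v = \<Gamma> v u) \<and>
     (\<forall>w u v. differential c (\<lambda>Q. g Q u v) P w = g P (\<Gamma> w u) v + g P u (\<Gamma> w v)))"

definition hessian ::
    "('s, 'e::euclidean_space) chart \<Rightarrow> ('s \<Rightarrow> 'e \<Rightarrow> 'e \<Rightarrow> real) \<Rightarrow> ('s \<Rightarrow> real) \<Rightarrow>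
     's \<Rightarrow> 'e \<Rightarrow> 'e \<Rightarrow> real" where
  "hessian c g f P u v =
     differential c (\<lambda>Q. differential c f Q v) P u - differential c f P (levi_civita c g P u v)"

definition lightlike :: "('e::real_vector \<Rightarrow> 'e \<Rightarrow> real) \<Rightarrow> 'e \<Rightarrow> bool" where
  "lightlike b v \<longleftrightarrow> v \<noteq> 0 \<and> b v v = 0"

text \<open>For a regular level set \<open>\<Phi> = 0\<close> contained in the domain of \<open>c\<close>, seen as boundary of the
  region \<open>\<Phi> > 0\<close>; its tangent vectors are those annihilated by \<open>d\<Phi>\<close>.\<close>

definition strongly_light_convex ::
    "('s, 'e::euclidean_space) chart \<Rightarrow> ('s \<Rightarrow> 'e \<Rightarrow> 'e \<Rightarrow> real) \<Rightarrow> ('s \<Rightarrow> real) \<Rightarrow> bool" where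
  "strongly_light_convex c g \<Phi> \<longleftrightarrow>
     (\<forall>P\<in>fst c. \<Phi> P = 0 \<longrightarrow>
        (\<forall>v. lightlike (g P) v \<and> differential c \<Phi> P v = 0 \<longrightarrow> hessian c g \<Phi> P v v < 0))"


subsection \<open>Standard stationary spacetimes\<close>

definition standard_stationary ::
    "('s::{t2_space, second_countable_topology}, real^'n) chart set \<Rightarrow>
     ('s, real^'n) bilinear_field \<Rightarrow> ('s, real^'n) covector_field \<Rightarrow> ('s \<Rightarrow> real) \<Rightarrow> bool" where
  "standard_stationary A g0 \<omega>0 \<beta> \<longleftrightarrow>
     smooth_manifold A \<and> riemannian_metric A g0 \<and> one_form A \<omega>0 \<and>
     smooth_function A \<beta> \<and> (\<forall>x. \<beta> x > 0)"

text \<open>The chart of \<open>S \<times> \<real>\<close> induced by a chart of \<open>S\<close>.\<close>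

definition time_chart :: "('s, 'e) chart \<Rightarrow> ('s \<times> real, 'e \<times> real) chart" where
  "time_chart c = (fst c \<times> UNIV, \<lambda>(x, t). (snd c x, t))"

text \<open>Components of \<open>g\<^sub>L\<close> in \<open>time_chart c\<close>; the bilinear form polarises the quadratic form
  \<open>g\<^sub>0(y,y) + 2 \<omega>\<^sub>0(y) \<tau> - \<beta> \<tau>\<^sup>2\<close>.\<close>

definition stationary_metric ::
    "('s, 'e) bilinear_field \<Rightarrow> ('s, 'e) covector_field \<Rightarrow> ('s \<Rightarrow> real) \<Rightarrow> ('s, 'e) chart \<Rightarrow>
     's \<times> real \<Rightarrow> 'e \<times> real \<Rightarrow> 'e \<times> real \<Rightarrow> real" where
  "stationary_metric g0 \<omega>0 \<beta> c =
     (\<lambda>(x, t) (y, \<tau>) (y', \<tau>').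
        g0 c x y y' + \<omega>0 c x y * \<tau>' + \<omega>0 c x y' * \<tau> - \<beta> x * \<tau> * \<tau>')"

definition h_metric ::
    "('s, 'e) bilinear_field \<Rightarrow> ('s, 'e) covector_field \<Rightarrow> ('s \<Rightarrow> real) \<Rightarrow>
     ('s, 'e) bilinear_field" where
  "h_metric g0 \<omega>0 \<beta> c x y y' = \<omega>0 c x y * \<omega>0 c x y' / (\<beta> x)\<^sup>2 + g0 c x y y' / \<beta> x"

definition omega_form ::
    "('s, 'e) covector_field \<Rightarrow> ('s \<Rightarrow> real) \<Rightarrow> ('s, 'e) covector_field" where
  "omega_form \<omega>0 \<beta> c x y = \<omega>0 c x y / \<beta> x"


subsection \<open>Geodesic conformal asymptotic flatness\<close>

text \<open>\<open>c\<close> is an asymptotic chart of the end \<open>E\<close> for the tensor fields \<open>h\<close> and \<open>\<omega>\<close>. Only the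
  exterior of some coordinate ball is required to be covered by the coordinates.\<close>

definition asymptotic_chart ::
    "('s, real^'n) chart set \<Rightarrow> ('s, real^'n) bilinear_field \<Rightarrow> ('s, real^'n) covector_field \<Rightarrow>
     's set \<Rightarrow> ('s, real^'n) chart \<Rightarrow> bool" where
  "asymptotic_chart A h \<omega> E c \<longleftrightarrow>
     c \<in> A \<and> fst c \<subseteq> E \<and> (\<exists>R. {z. norm z > R} \<subseteq> snd c ` fst c) \<and>
     (\<exists>p>0. \<exists>q>0.
        (\<forall>i j. in_coords c (\<lambda>x. h c x (axis i 1) (axis j 1) - (if i = j then 1 else 0))
               \<in> O[at_infinity](\<lambda>z. 1 / norm z powr p)) \<and>
        (\<forall>i j k. in_coords c
                 (\<lambda>x. differential c (\<lambda>x'. h c x' (axis i 1) (axis j 1)) x (axis k 1))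
               \<in> O[at_infinity](\<lambda>z. 1 / norm z powr (p + 1))) \<and>
        (\<forall>i j. in_coords c
                 (\<lambda>x. differential c (\<lambda>x'. \<omega> c x' (axis j 1)) x (axis i 1)
                    - differential c (\<lambda>x'. \<omega> c x' (axis i 1)) x (axis j 1))
               \<in> O[at_infinity](\<lambda>z. 1 / norm z powr (q + 1))))"

text \<open>The witnesses of the definition (compact core \<open>K\<close>, ends \<open>E 1, \<dots>, E m\<close> and their
  asymptotic charts \<open>X 1, \<dots>, X m\<close>) are kept as parameters, since coordinate spheres refer to
  them. An end is diffeomorphic to \<open>\<real>\<^sup>n - {0}\<close> iff it is the domain of a chart of the
  maximal atlas with that image.\<close>

definition geodesically_conformally_asymptotically_flat ::
    "('s::topological_space, real^'n) chart set \<Rightarrow>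
     ('s, real^'n) bilinear_field \<Rightarrow> ('s, real^'n) covector_field \<Rightarrow> ('s \<Rightarrow> real) \<Rightarrow>
     's set \<Rightarrow> nat \<Rightarrow> (nat \<Rightarrow> 's set) \<Rightarrow> (nat \<Rightarrow> ('s, real^'n) chart) \<Rightarrow> bool" where
  "geodesically_conformally_asymptotically_flat A g0 \<omega>0 \<beta> K m E X \<longleftrightarrow>
     compact K \<and> 1 \<le> m \<and> disjoint_family_on E {1..m} \<and> - K = (\<Union>k\<in>{1..m}. E k) \<and>
     (\<forall>k\<in>{1..m}.
        (\<exists>\<psi>. (E k, \<psi>) \<in> A \<and> \<psi> ` E k = - {0}) \<and>
        asymptotic_chart A (h_metric g0 \<omega>0 \<beta>) (omega_form \<omega>0 \<beta>) (E k) (X k))"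

definition sphere_function :: "('s, real^'n) chart \<Rightarrow> real \<Rightarrow> 's \<times> real \<Rightarrow> real" where
  "sphere_function c r0 = (\<lambda>(x, t). r0\<^sup>2 - (norm (snd c x))\<^sup>2)"

end

theory Submission
  imports Defs
begin

text \<open>Completing the square, \<open>g\<^sub>L = \<beta> (h - (d\<tau> - \<omega>)\<^sup>2)\<close>. Let \<open>v = (y, \<tau>)\<close> be lightlike and tangent to
  the cylinder over the sphere through a point with coordinate vector \<open>z\<close>, put
  \<open>\<sigma> = \<tau> - \<omega>(y)\<close>, so \<open>\<sigma>\<^sup>2 = h(y,y)\<close>, and let \<open>U\<close> be the vector with \<open>h(U,w) = z \<bullet> w\<close> for all
  \<open>w\<close>. The Koszul formula (\<open>levi_civita_diagonal\<close>), tested against the \<open>g\<^sub>L\<close>-gradient of \<open>\<Phi>\<close>, gives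
  (\<open>hessian_sphere_function\<close>) that \<open>H\<^sub>\<Phi>(v,v)\<close> equals
  \<open>- 2 (y \<bullet> y) + 2 (\<partial>\<^sub>y h(y,U) - \<partial>\<^sub>U h(y,y) / 2 + \<sigma> d\<omega>(y,U))\<close>: the derivative of \<open>\<beta>\<close> drops out,
  which reflects the conformal invariance of light-convexity.

  The decay conditions make \<open>h - \<delta>\<close>, \<open>\<bar>z\<bar> \<partial>h\<close> and \<open>\<bar>z\<bar> d\<omega>\<close> tend to zero
  (\<open>asymptotic_chart_small\<close>). Hence \<open>\<bar>U\<bar> \<le> 2 \<bar>z\<bar>\<close> and \<open>\<bar>\<sigma>\<bar> \<le> 2 \<bar>y\<bar>\<close> for large \<open>\<bar>z\<bar>\<close>, and the
  error terms are dominated by \<open>y \<bullet> y\<close> (\<open>null_hessian_estimate\<close>). Finally \<open>y \<noteq> 0\<close>, as \<open>y = 0\<close>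
  forces \<open>\<sigma> = 0\<close>, \<open>\<tau> = 0\<close> and \<open>v = 0\<close>.\<close>

section \<open>Differentials in a chart\<close>

text \<open>The part of \<open>is_chart\<close> that matters for differentiation: the coordinates are injective
  and their range is open. No topology on the manifold is involved.\<close>

definition open_chart :: "('s, 'e::real_normed_vector) chart \<Rightarrow> bool" where
  "open_chart c \<longleftrightarrow> open (snd c ` fst c) \<and> inj_on (snd c) (fst c)"

text \<open>\<open>D\<close> is the differential of \<open>f\<close> at \<open>P\<close> in the coordinates \<open>c\<close>; in contrast to
  \<open>differential\<close>, this includes that \<open>f\<close> is differentiable.\<close>

definition has_differential ::
    "('s, 'e::real_normed_vector) chart \<Rightarrow> ('s \<Rightarrow> 'b::real_normed_vector) \<Rightarrow> 's \<Rightarrow> ('e \<Rightarrow> 'b) \<Rightarrow> bool"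
  where "has_differential c f P D \<longleftrightarrow> (in_coords c f has_derivative D) (at (snd c P))"

lemma in_coords_apply:
  assumes "open_chart c" "P \<in> fst c"
  shows "in_coords c f (snd c P) = f P"
  using assms by (simp add: in_coords_def open_chart_def)

lemma has_differential_imp_differential:
  "has_differential c f P D \<Longrightarrow> differential c f P = D"
  unfolding has_differential_def differential_def by (metis frechet_derivative_at)

lemma has_differential_linear: "has_differential c f P D \<Longrightarrow> linear D"
  unfolding has_differential_def by (rule has_derivative_linear)

lemma has_differential_unique:
  "has_differential c f P D \<Longrightarrow> has_differential c f P D' \<Longrightarrow> D = D'"
  using has_differential_imp_differential by metis

lemma has_differential_coords:
  assumes c: "open_chart c" and P: "P \<in> fst c"
    and F: "(F has_derivative D) (at (snd c P))"
    and eq: "\<And>Q. Q \<in> fst c \<Longrightarrow> f Q = F (snd c Q)"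
  shows "has_differential c f P D"
  unfolding has_differential_def
proof (rule has_derivative_transform_within_open[OF F])
  show "open (snd c ` fst c)" using c by (simp add: open_chart_def)
  show "snd c P \<in> snd c ` fst c" using P by simp
  show "F z = in_coords c f z" if "z \<in> snd c ` fst c" for z
    using that eq in_coords_apply[OF c, of _ f] by auto
qed

lemma has_differential_cong:
  assumes "open_chart c" "P \<in> fst c" "has_differential c f P D"
    and "\<And>Q. Q \<in> fst c \<Longrightarrow> f Q = f' Q"
  shows "has_differential c f' P D"
  by (rule has_differential_coords[OF assms(1,2)])
    (use assms(3,4) in_coords_apply[OF assms(1), of _ f] in \<open>auto simp: has_differential_def\<close>)

lemma has_differential_add:
  "has_differential c f P D \<Longrightarrow> has_differential c g P D' \<Longrightarrow>
   has_differential c (\<lambda>Q. f Q + g Q) P (\<lambda>a. D a + D' a)"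
  unfolding has_differential_def in_coords_def o_def by (rule has_derivative_add)

lemma has_differential_scaleR:
  "has_differential c f P D \<Longrightarrow> has_differential c (\<lambda>Q. r *\<^sub>R f Q) P (\<lambda>a. r *\<^sub>R D a)"
  unfolding has_differential_def in_coords_def o_def by (rule has_derivative_scaleR_right)

lemma differential_bilinear:
  fixes f :: "'s \<Rightarrow> 'v::real_vector \<Rightarrow> 'w::real_vector \<Rightarrow> real"
  assumes c: "open_chart c" and P: "P \<in> fst c"
    and f: "\<And>Q. Q \<in> fst c \<Longrightarrow> bilinear (f Q)"
    and D: "\<And>u v. has_differential c (\<lambda>Q. f Q u v) P (D u v)"
  shows "bilinear (\<lambda>u v. D u v w)"
proof -
  have "D (u + u') v = (\<lambda>a. D u v a + D u' v a)" for u u' v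
    by (rule has_differential_unique[OF D has_differential_cong[OF c P has_differential_add[OF D D]]])
      (simp add: bilinear_ladd[OF f])
  moreover have "D (r *\<^sub>R u) v = (\<lambda>a. r *\<^sub>R D u v a)" for u v r
    by (rule has_differential_unique[OF D has_differential_cong[OF c P has_differential_scaleR[OF D]]])
      (simp add: bilinear_lmul[OF f])
  moreover have "D u (v + v') = (\<lambda>a. D u v a + D u v' a)" for u v v'
    by (rule has_differential_unique[OF D has_differential_cong[OF c P has_differential_add[OF D D]]])
      (simp add: bilinear_radd[OF f])
  moreover have "D u (r *\<^sub>R v) = (\<lambda>a. r *\<^sub>R D u v a)" for u v r
    by (rule has_differential_unique[OF D has_differential_cong[OF c P has_differential_scaleR[OF D]]])
      (simp add: bilinear_rmul[OF f])
  ultimately show ?thesis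
    unfolding bilinear_def by (intro conjI allI linearI) simp_all
qed

lemma differential_linear:
  fixes f :: "'s \<Rightarrow> 'v::real_vector \<Rightarrow> real"
  assumes c: "open_chart c" and P: "P \<in> fst c"
    and f: "\<And>Q. Q \<in> fst c \<Longrightarrow> linear (f Q)"
    and D: "\<And>u. has_differential c (\<lambda>Q. f Q u) P (D u)"
  shows "linear (\<lambda>u. D u w)"
proof -
  have "D (u + u') = (\<lambda>a. D u a + D u' a)" for u u'
    by (rule has_differential_unique[OF D has_differential_cong[OF c P has_differential_add[OF D D]]])
      (simp add: linear_add[OF f])
  moreover have "D (r *\<^sub>R u) = (\<lambda>a. r *\<^sub>R D u a)" for u r
    by (rule has_differential_unique[OF D has_differential_cong[OF c P has_differential_scaleR[OF D]]])
      (simp add: linear_scale[OF f])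
  ultimately show ?thesis
    by (intro linearI) simp_all
qed

lemma smooth_on_imp_has_differential:
  assumes c: "open_chart c" and P: "P \<in> fst c"
    and f: "smooth_on (snd c ` fst c) (in_coords c f)"
  shows "has_differential c f P (differential c f P)"
proof -
  have "Ck_on (Suc 0) (snd c ` fst c) (in_coords c f)"
    using f unfolding smooth_on_def by blast
  then have "in_coords c f differentiable (at (snd c P) within snd c ` fst c)"
    using P by (auto simp: differentiable_on_def)
  moreover have "at (snd c P) within snd c ` fst c = at (snd c P)"
    by (rule at_within_open) (use c P in \<open>auto simp: open_chart_def\<close>)
  ultimately have "in_coords c f differentiable (at (snd c P))" by metis
  then show ?thesis
    unfolding has_differential_def differential_def using frechet_derivative_works by blast
qed

lemma open_chart_time_chart:
  assumes "open_chart c"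
  shows "open_chart (time_chart c)"
proof -
  have "snd (time_chart c) ` fst (time_chart c) = (snd c ` fst c) \<times> UNIV"
    unfolding time_chart_def by force
  moreover have "inj_on (snd (time_chart c)) (fst (time_chart c))"
    using assms unfolding open_chart_def time_chart_def inj_on_def by auto
  ultimately show ?thesis
    using assms unfolding open_chart_def by (simp add: open_Times)
qed

lemma has_differential_time_chart:
  assumes c: "open_chart c" and x: "x \<in> fst c" and f: "has_differential c f x D"
  shows "has_differential (time_chart c) (\<lambda>Q. f (fst Q)) (x, t) (\<lambda>a. D (fst a))"
proof (rule has_differential_coords[OF open_chart_time_chart[OF c]])
  show "(x, t) \<in> fst (time_chart c)" using x by (simp add: time_chart_def)
  have "(in_coords c f has_derivative D) (at (fst (snd c x, t)))"
    using f by (simp add: has_differential_def)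
  from has_derivative_compose[OF has_derivative_fst[OF has_derivative_ident] this]
  show "((\<lambda>z. in_coords c f (fst z)) has_derivative (\<lambda>a. D (fst a)))
      (at (snd (time_chart c) (x, t)))"
    by (simp add: time_chart_def)
  show "f (fst Q) = in_coords c f (fst (snd (time_chart c) Q))" if "Q \<in> fst (time_chart c)" for Q
    using that in_coords_apply[OF c, of _ f] by (auto simp: time_chart_def)
qed


section \<open>The Levi-Civita connection of a semi-Riemannian metric\<close>

lemma nondegenerate_representation:
  fixes b :: "'e::euclidean_space \<Rightarrow> 'e \<Rightarrow> real"
  assumes b: "bilinear b" and nondeg: "\<And>u. (\<And>v. b u v = 0) \<Longrightarrow> u = 0" and f: "linear f"
  shows "\<exists>u. \<forall>v. b u v = f v"
proof -
  define G where "G u = (\<Sum>i\<in>Basis. b u i *\<^sub>R i)" for u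
  have G_inner: "G u \<bullet> i = b u i" if "i \<in> Basis" for u i
    using that by (simp add: G_def)
  have b_eq: "b u v = g v" if "linear g" "\<And>i. i \<in> Basis \<Longrightarrow> b u i = g i" for u v g
  proof -
    have "linear (b u)" using b by (simp add: bilinear_def)
    from linear_eq_stdbasis[OF this that(1)] that(2) show ?thesis by metis
  qed
  have "linear G"
    by (rule linearI)
      (simp_all add: G_def bilinear_ladd[OF b] bilinear_lmul[OF b] scaleR_left_distrib
        sum.distrib scaleR_sum_right)
  moreover have "inj G"
    unfolding linear_injective_0[OF \<open>linear G\<close>]
  proof (intro allI impI)
    fix u assume "G u = 0"
    then have "b u i = 0" if "i \<in> Basis" for i using G_inner[OF that, of u] by simp
    then have "b u v = 0" for v using b_eq[of "\<lambda>_. 0"] by (simp add: linear_zero)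
    then show "u = 0" by (rule nondeg)
  qed
  ultimately have "surj G" by (rule linear_injective_imp_surjective) simp
  then obtain u where "G u = (\<Sum>i\<in>Basis. f i *\<^sub>R i)" by (metis surjD)
  then have "b u i = f i" if "i \<in> Basis" for i
    using that G_inner[OF that, of u] by simp
  then show ?thesis using b_eq[OF f] by blast
qed

text \<open>The Koszul formula on the diagonal. The definite description in \<open>levi_civita\<close> is justified
  by solving the Koszul formula for the connection, which nondegeneracy makes possible.\<close>

lemma levi_civita_diagonal:
  fixes g :: "'s \<Rightarrow> 'e::euclidean_space \<Rightarrow> 'e \<Rightarrow> real"
  assumes bil: "bilinear (g P)" and sym: "\<And>u v. g P u v = g P v u"
    and nondeg: "\<And>u. (\<And>v. g P u v = 0) \<Longrightarrow> u = 0"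
    and D: "\<And>u v. has_differential c (\<lambda>Q. g Q u v) P (B u v)"
    and Bbil: "\<And>w. bilinear (\<lambda>u v. B u v w)"
    and Bsym: "\<And>u v w. B u v w = B v u w"
  shows "g P (levi_civita c g P v v) w = B v w v - B v v w / 2"
proof -
  define LC where "LC \<Gamma> \<longleftrightarrow> bilinear \<Gamma> \<and> (\<forall>u v. \<Gamma> u v = \<Gamma> v u) \<and>
     (\<forall>w u v. B u v w = g P (\<Gamma> w u) v + g P u (\<Gamma> w v))" for \<Gamma>
  have Blin: "linear (B u v)" for u v by (rule has_differential_linear[OF D])
  note glin = bilinear_ladd[OF bil] bilinear_lmul[OF bil] bilinear_radd[OF bil]
    bilinear_rmul[OF bil] bilinear_lsub[OF bil]
  note lin = linear_add[OF Blin] linear_scale[OF Blin] bilinear_ladd[OF Bbil]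
    bilinear_lmul[OF Bbil] bilinear_radd[OF Bbil] bilinear_rmul[OF Bbil]
  have eqI: "a = b" if "\<And>w. g P a w = g P b w" for a b
    using nondeg[of "a - b"] that by (simp add: glin)
  have koszul: "g P (\<Gamma> u v) w = (B v w u + B u w v - B u v w) / 2" if "LC \<Gamma>" for \<Gamma> u v w
  proof -
    have 1: "\<Gamma> u v = \<Gamma> v u" "\<Gamma> u w = \<Gamma> w u" "\<Gamma> v w = \<Gamma> w v"
      and 2: "B v w u = g P (\<Gamma> u v) w + g P v (\<Gamma> u w)"
        "B u w v = g P (\<Gamma> v u) w + g P u (\<Gamma> v w)"
        "B u v w = g P (\<Gamma> w u) v + g P u (\<Gamma> w v)"
      using that unfolding LC_def by blast+
    show ?thesis unfolding 2 1 using sym[of v "\<Gamma> w u"] by (simp add: field_simps)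
  qed
  have "\<forall>u v. \<exists>a. \<forall>w. g P a w = (B v w u + B u w v - B u v w) / 2"
    by (intro allI nondegenerate_representation[OF bil nondeg] linearI)
      (simp_all add: lin add_divide_distrib diff_divide_distrib right_diff_distrib distrib_left)
  then have "\<exists>\<Gamma>. \<forall>u v w. g P (\<Gamma> u v) w = (B v w u + B u w v - B u v w) / 2"
    unfolding choice_iff .
  then obtain \<Gamma> where \<Gamma>: "\<And>u v w. g P (\<Gamma> u v) w = (B v w u + B u w v - B u v w) / 2"
    by blast
  have "LC \<Gamma>"
    unfolding LC_def
  proof (intro conjI allI)
    have "\<Gamma> (u + u') v = \<Gamma> u v + \<Gamma> u' v" "\<Gamma> u (v + v') = \<Gamma> u v + \<Gamma> u v'"
      "\<Gamma> (r *\<^sub>R u) v = r *\<^sub>R \<Gamma> u v" "\<Gamma> u (r *\<^sub>R v) = r *\<^sub>R \<Gamma> u v" for u u' v v' r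
      by (rule eqI; simp add: \<Gamma> glin lin add_divide_distrib diff_divide_distrib
          right_diff_distrib distrib_left)+
    then show "bilinear \<Gamma>" unfolding bilinear_def by (intro conjI allI linearI) simp_all
    show "\<Gamma> u v = \<Gamma> v u" for u v
      by (rule eqI) (simp add: \<Gamma> Bsym[of u v])
    show "B u v w = g P (\<Gamma> w u) v + g P u (\<Gamma> w v)" for w u v
      unfolding sym[of u] \<Gamma> using Bsym[of u v] Bsym[of w] by (simp add: field_simps)
  qed
  moreover have "\<Gamma>' = \<Gamma>" if "LC \<Gamma>'" for \<Gamma>'
    by (intro ext eqI) (simp add: koszul[OF that] \<Gamma>)
  ultimately have "LC (THE \<Gamma>. LC \<Gamma>)" by (rule theI)
  moreover have "levi_civita c g P = (THE \<Gamma>. LC \<Gamma>)"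
    unfolding levi_civita_def LC_def has_differential_imp_differential[OF D] ..
  ultimately have "LC (levi_civita c g P)" by simp
  from koszul[OF this] show ?thesis by (simp add: Bsym[of w] field_simps)
qed


section \<open>The Hessian of the sphere function\<close>

lemma differential_sphere_function:
  assumes c: "open_chart c" and Q: "Q \<in> fst (time_chart c)"
  shows "differential (time_chart c) (sphere_function c r0) Q = (\<lambda>a. - 2 * (snd c (fst Q) \<bullet> fst a))"
proof (rule has_differential_imp_differential,
    rule has_differential_coords[OF open_chart_time_chart[OF c] Q,
      where F = "\<lambda>z. r0\<^sup>2 - fst z \<bullet> fst z"])
  show "((\<lambda>z. r0\<^sup>2 - fst z \<bullet> fst z) has_derivative (\<lambda>a. - 2 * (snd c (fst Q) \<bullet> fst a)))
      (at (snd (time_chart c) Q))"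
    by (auto intro!: derivative_eq_intros simp: time_chart_def case_prod_beta inner_commute)
  show "sphere_function c r0 Q' = r0\<^sup>2 - fst (snd (time_chart c) Q') \<bullet> fst (snd (time_chart c) Q')"
    for Q'
    by (simp add: sphere_function_def time_chart_def case_prod_beta power2_norm_eq_inner)
qed

lemma differential_differential_sphere_function:
  assumes c: "open_chart c" and P: "P \<in> fst (time_chart c)"
  shows "differential (time_chart c)
     (\<lambda>Q. differential (time_chart c) (sphere_function c r0) Q v) P = (\<lambda>a. - 2 * (fst a \<bullet> fst v))"
proof (rule has_differential_imp_differential,
    rule has_differential_coords[OF open_chart_time_chart[OF c] P,
      where F = "\<lambda>z. - 2 * (fst z \<bullet> fst v)"])
  show "((\<lambda>z. - 2 * (fst z \<bullet> fst v)) has_derivative (\<lambda>a. - 2 * (fst a \<bullet> fst v)))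
      (at (snd (time_chart c) P))"
    by (auto intro!: derivative_eq_intros)
  show "differential (time_chart c) (sphere_function c r0) Q v =
      - 2 * (fst (snd (time_chart c) Q) \<bullet> fst v)" if "Q \<in> fst (time_chart c)" for Q
    by (simp add: differential_sphere_function[OF c that]) (simp add: time_chart_def case_prod_beta)
qed

lemma stationary_metric_conformal:
  assumes "\<And>x. \<beta> x > 0"
  shows "stationary_metric g0 \<omega>0 \<beta> c = (\<lambda>Q v v'. \<beta> (fst Q) *
     (h_metric g0 \<omega>0 \<beta> c (fst Q) (fst v) (fst v') -
      (snd v - omega_form \<omega>0 \<beta> c (fst Q) (fst v)) *
      (snd v' - omega_form \<omega>0 \<beta> c (fst Q) (fst v'))))"
proof -
  have "\<beta> x \<noteq> 0" for x using assms[of x] by simp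
  then show ?thesis
    unfolding stationary_metric_def h_metric_def omega_form_def
    by (intro ext) (simp add: case_prod_beta field_simps power2_eq_square)
qed

text \<open>The Hessian of the sphere function in null directions tangent to its level set, for a metric
  \<open>\<beta> (h - (d\<tau> - \<omega>)\<^sup>2)\<close>. Here \<open>Dh u v a\<close> and \<open>D\<omega> u a\<close> are the derivatives in direction \<open>a\<close> of
  \<open>h(u,v)\<close> and \<open>\<omega>(u)\<close>, and \<open>U\<close> is the \<open>h\<close>-gradient of \<open>\<bar>x\<bar>\<^sup>2 / 2\<close>. The derivative of \<open>\<beta>\<close> does not
  enter, as it is multiplied by \<open>g(v,v) = 0\<close> and \<open>d\<Phi>(v) = 0\<close>.\<close>

lemma hessian_sphere_function:
  fixes c :: "('s, real^'n) chart" and \<beta> :: "'s \<Rightarrow> real"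
    and h :: "'s \<Rightarrow> real^'n \<Rightarrow> real^'n \<Rightarrow> real" and \<omega> :: "'s \<Rightarrow> real^'n \<Rightarrow> real"
    and G :: "'s \<times> real \<Rightarrow> (real^'n) \<times> real \<Rightarrow> (real^'n) \<times> real \<Rightarrow> real"
  assumes G_def: "G = (\<lambda>Q v v'. \<beta> (fst Q) * (h (fst Q) (fst v) (fst v') -
      (snd v - \<omega> (fst Q) (fst v)) * (snd v' - \<omega> (fst Q) (fst v'))))"
    and c: "open_chart c" and x: "x \<in> fst c" and \<beta>: "\<beta> x > 0"
    and hbil: "\<And>Q. Q \<in> fst c \<Longrightarrow> bilinear (h Q)"
    and hsym: "\<And>Q u v. Q \<in> fst c \<Longrightarrow> h Q u v = h Q v u"
    and hpos: "\<And>u. u \<noteq> 0 \<Longrightarrow> h x u u > 0"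
    and \<omega>lin: "\<And>Q. Q \<in> fst c \<Longrightarrow> linear (\<omega> Q)"
    and D\<beta>: "has_differential c \<beta> x D\<beta>"
    and Dh: "\<And>u v. has_differential c (\<lambda>Q. h Q u v) x (Dh u v)"
    and D\<omega>: "\<And>u. has_differential c (\<lambda>Q. \<omega> Q u) x (D\<omega> u)"
    and null: "G (x, t) (y, \<tau>) (y, \<tau>) = 0" and tangent: "snd c x \<bullet> y = 0"
    and U: "\<And>w. h x U w = snd c x \<bullet> w"
  shows "hessian (time_chart c) G (sphere_function c r0) (x, t) (y, \<tau>) (y, \<tau>) =
    - 2 * (y \<bullet> y) +
    2 * (Dh y U y - Dh y y U / 2 + (\<tau> - \<omega> x y) * (D\<omega> U y - D\<omega> y U))"
proof -
  define P where "P = (x, t)"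
  define v where "v = (y, \<tau>)"
  define W where "W = (U /\<^sub>R \<beta> x, \<omega> x U / \<beta> x)"
  \<comment> \<open>\<open>B u u' a\<close> is the derivative of \<open>G(u,u')\<close> in direction \<open>a\<close>; nothing depends on time.\<close>
  define B where "B u u' a = D\<beta> (fst a) * (h x (fst u) (fst u') -
      (snd u - \<omega> x (fst u)) * (snd u' - \<omega> x (fst u'))) +
    \<beta> x * (Dh (fst u) (fst u') (fst a) + D\<omega> (fst u) (fst a) * (snd u' - \<omega> x (fst u')) +
      (snd u - \<omega> x (fst u)) * D\<omega> (fst u') (fst a))"
    for u u' :: "(real^'n) \<times> real" and a :: "(real^'n) \<times> real"
  have P: "P \<in> fst (time_chart c)" using x by (simp add: P_def time_chart_def)
  note bil = hbil[OF x] and lin = \<omega>lin[OF x]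
  note hlin = bilinear_ladd[OF bil] bilinear_lmul[OF bil] bilinear_radd[OF bil]
    bilinear_rmul[OF bil] linear_add[OF lin] linear_scale[OF lin]
  have Dhbil: "bilinear (\<lambda>u v. Dh u v w)" for w
    by (rule differential_bilinear[OF c x hbil Dh])
  have D\<omega>lin: "linear (\<lambda>u. D\<omega> u w)" for w
    by (rule differential_linear[OF c x \<omega>lin D\<omega>])
  note Dlin = bilinear_ladd[OF Dhbil] bilinear_lmul[OF Dhbil] bilinear_radd[OF Dhbil]
    bilinear_rmul[OF Dhbil] linear_add[OF D\<omega>lin] linear_scale[OF D\<omega>lin]
    linear_scale[OF has_differential_linear[OF D\<beta>]]
    linear_scale[OF has_differential_linear[OF Dh]] linear_scale[OF has_differential_linear[OF D\<omega>]]
  have GP: "G P u w = \<beta> x * (h x (fst u) (fst w) -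
      (snd u - \<omega> x (fst u)) * (snd w - \<omega> x (fst w)))" for u w
    by (simp add: G_def P_def)
  have Gbil: "bilinear (G Q)" if "Q \<in> fst (time_chart c)" for Q
  proof -
    have Q: "fst Q \<in> fst c" using that by (auto simp: time_chart_def)
    show ?thesis
      unfolding bilinear_def
      by (intro conjI allI linearI)
        (simp_all add: G_def bilinear_ladd[OF hbil[OF Q]] bilinear_lmul[OF hbil[OF Q]]
          bilinear_radd[OF hbil[OF Q]] bilinear_rmul[OF hbil[OF Q]] linear_add[OF \<omega>lin[OF Q]]
          linear_scale[OF \<omega>lin[OF Q]] algebra_simps)
  qed
  have Gsym: "G Q u w = G Q w u" if "Q \<in> fst (time_chart c)" for Q u w
  proof -
    have "fst Q \<in> fst c" using that by (auto simp: time_chart_def)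
    then show ?thesis by (simp add: G_def hsym[of _ "fst u"] mult.commute)
  qed
  have Gnondeg: "u = 0" if "\<And>w. G P u w = 0" for u
  proof -
    have 1: "snd u = \<omega> x (fst u)"
      using that[of "(0, 1)"] \<beta> by (simp add: GP bilinear_rzero[OF bil] linear_0[OF lin])
    then have "h x (fst u) (fst u) = 0" using that[of u] \<beta> by (simp add: GP)
    then have "fst u = 0" using hpos[of "fst u"] by force
    then show ?thesis using 1 linear_0[OF lin] by (simp add: prod_eq_iff)
  qed
  have GB: "has_differential (time_chart c) (\<lambda>Q. G Q u u') P (B u u')" for u u'
  proof -
    have D: "has_differential c (\<lambda>Q. \<beta> Q * (h Q (fst u) (fst u') -
        (snd u - \<omega> Q (fst u)) * (snd u' - \<omega> Q (fst u')))) x (\<lambda>a. B u u' (a, 0))"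
    proof -
      have [simp]: "in_coords c f (snd c x) = f x" for f :: "'s \<Rightarrow> real"
        by (rule in_coords_apply[OF c x])
      have eq: "in_coords c (\<lambda>Q. \<beta> Q * (h Q (fst u) (fst u') -
          (snd u - \<omega> Q (fst u)) * (snd u' - \<omega> Q (fst u')))) =
        (\<lambda>z. in_coords c \<beta> z * (in_coords c (\<lambda>Q. h Q (fst u) (fst u')) z -
          (snd u - in_coords c (\<lambda>Q. \<omega> Q (fst u)) z) *
          (snd u' - in_coords c (\<lambda>Q. \<omega> Q (fst u')) z)))"
        by (simp add: in_coords_def o_def)
      show ?thesis
        unfolding has_differential_def eq
        by (rule derivative_eq_intros D\<beta>[unfolded has_differential_def]
            Dh[unfolded has_differential_def] D\<omega>[unfolded has_differential_def] refl)+
          (simp add: B_def algebra_simps)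
    qed
    have "B u u' = (\<lambda>a. B u u' (fst a, 0))"
      by (simp add: B_def fun_eq_iff)
    then show ?thesis
      using has_differential_time_chart[OF c x D, of t] unfolding G_def P_def by simp
  qed
  have Bbil: "bilinear (\<lambda>u u'. B u u' w)" for w
    by (rule differential_bilinear[OF open_chart_time_chart[OF c] P Gbil GB])
  have Bsym: "B u u' w = B u' u w" for u u' w
  proof -
    have "B u u' = B u' u"
      by (rule has_differential_unique[OF GB
            has_differential_cong[OF open_chart_time_chart[OF c] P GB]]) (rule Gsym)
    then show ?thesis by simp
  qed
  have LC: "G P (levi_civita (time_chart c) G P v v) W = B v W v - B v v W / 2"
    by (rule levi_civita_diagonal[OF Gbil[OF P] Gsym[OF P] Gnondeg GB Bbil Bsym])

  \<comment> \<open>\<open>W\<close> is the gradient of \<open>- \<Phi> / 2\<close>.\<close>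
  have GW: "G P w W = snd c x \<bullet> fst w" for w
    using \<beta> by (simp add: GP W_def hlin hsym[OF x, of "fst w"] U divide_inverse mult.commute)
  have 1: "h x y y = (\<tau> - \<omega> x y) * (\<tau> - \<omega> x y)"
    using null \<beta> by (simp add: G_def)
  have 2: "h x y (U /\<^sub>R \<beta> x) = 0"
    by (simp add: hlin hsym[OF x, of y] U tangent)
  have "B v W v = Dh y U y + (\<tau> - \<omega> x y) * D\<omega> U y"
    using \<beta> by (simp add: B_def v_def W_def 2) (simp add: hlin Dlin field_simps)
  moreover have "B v v W = Dh y y U + 2 * (\<tau> - \<omega> x y) * D\<omega> y U"
    using \<beta> by (simp add: B_def v_def W_def 1) (simp add: hlin Dlin field_simps)
  ultimately have "snd c x \<bullet> fst (levi_civita (time_chart c) G P v v) =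
      Dh y U y - Dh y y U / 2 + (\<tau> - \<omega> x y) * (D\<omega> U y - D\<omega> y U)"
    using LC unfolding GW by (simp add: algebra_simps)
  then show ?thesis
    unfolding hessian_def P_def[symmetric] v_def[symmetric]
      differential_differential_sphere_function[OF c P] differential_sphere_function[OF c P]
    by (simp add: P_def v_def)
qed


section \<open>Estimates near infinity\<close>

lemma linear_bound_axis:
  fixes f :: "real^'n \<Rightarrow> real"
  assumes f: "linear f" and b: "\<And>i. \<bar>f (axis i 1)\<bar> \<le> e"
  shows "\<bar>f x\<bar> \<le> real CARD('n) * e * norm x"
proof -
  have "f x = f (\<Sum>i\<in>UNIV. x $ i *\<^sub>R axis i 1)"
    using basis_expansion[of x] by (simp add: scalar_mult_eq_scaleR)
  also have "\<dots> = (\<Sum>i\<in>UNIV. x $ i * f (axis i 1))"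
    by (simp add: linear_sum[OF f] linear_scale[OF f])
  finally have "\<bar>f x\<bar> \<le> (\<Sum>i\<in>UNIV. \<bar>x $ i * f (axis i 1)\<bar>)" by simp
  also have "\<dots> \<le> (\<Sum>i\<in>(UNIV :: 'n set). norm x * e)"
    by (intro sum_mono) (auto simp: abs_mult intro!: mult_mono component_le_norm_cart b)
  finally show ?thesis by (simp add: mult_ac)
qed

lemma bilinear_bound_axis:
  fixes f :: "real^'n \<Rightarrow> real^'n \<Rightarrow> real"
  assumes f: "bilinear f" and b: "\<And>i j. \<bar>f (axis i 1) (axis j 1)\<bar> \<le> e"
  shows "\<bar>f u v\<bar> \<le> (real CARD('n))\<^sup>2 * e * norm u * norm v"
proof -
  have "\<bar>f u (axis j 1)\<bar> \<le> real CARD('n) * e * norm u" for j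
    by (rule linear_bound_axis[where f = "\<lambda>x. f x (axis j 1)"])
      (use f b in \<open>simp_all add: bilinear_def\<close>)
  then have "\<bar>f u v\<bar> \<le> real CARD('n) * (real CARD('n) * e * norm u) * norm v"
    by (rule linear_bound_axis[rotated]) (use f in \<open>simp_all add: bilinear_def\<close>)
  then show ?thesis by (simp add: power2_eq_square mult_ac)
qed

lemma eventually_small_of_bigo:
  fixes f :: "'a::real_normed_vector \<Rightarrow> real"
  assumes f: "f \<in> O[at_infinity](\<lambda>z. 1 / norm z powr p)" and "p > 0" "e > 0"
  shows "\<forall>\<^sub>F z in at_infinity. \<bar>f z\<bar> \<le> e"
proof -
  obtain C where C: "C > 0" "\<forall>\<^sub>F z in at_infinity. norm (f z) \<le> C * norm (1 / norm z powr p)"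
    using f by (elim landau_o.bigE)
  have "((\<lambda>z::'a. norm z powr (- p)) \<longlongrightarrow> 0) at_infinity"
    using \<open>p > 0\<close> by (intro tendsto_neg_powr filterlim_norm_at_top) auto
  then have "\<forall>\<^sub>F z::'a in at_infinity. norm z powr (- p) < e / C"
    using C(1) \<open>e > 0\<close> by (intro order_tendstoD(2)) auto
  with C(2) show ?thesis
  proof eventually_elim
    case (elim z)
    then have "\<bar>f z\<bar> \<le> C * norm z powr (- p)" by (simp add: powr_minus_divide)
    also have "\<dots> \<le> e" using elim(2) C(1) by (simp add: field_simps)
    finally show ?case .
  qed
qed

lemma eventually_norm_times_small_of_bigo:
  fixes f :: "'a::real_normed_vector \<Rightarrow> real"
  assumes f: "f \<in> O[at_infinity](\<lambda>z. 1 / norm z powr (p + 1))" and "p > 0" "e > 0"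
  shows "\<forall>\<^sub>F z in at_infinity. norm z * \<bar>f z\<bar> \<le> e"
proof -
  have "(\<lambda>z. norm z * f z) \<in> O[at_infinity](\<lambda>z. norm z * (1 / norm z powr (p + 1)))"
    by (intro landau_o.big.mult landau_o.big_refl f)
  also have "(\<lambda>z::'a. norm z * (1 / norm z powr (p + 1))) = (\<lambda>z. 1 / norm z powr p)"
  proof
    fix z :: 'a
    show "norm z * (1 / norm z powr (p + 1)) = 1 / norm z powr p"
      by (cases "z = 0") (simp_all add: powr_add)
  qed
  finally have "\<forall>\<^sub>F z in at_infinity. \<bar>norm z * f z\<bar> \<le> e"
    using assms(2,3) by (rule eventually_small_of_bigo)
  then show ?thesis by (simp add: abs_mult)
qed

text \<open>The bounds give \<open>\<bar>U\<bar> \<le> 2 \<bar>z\<bar>\<close> and \<open>\<bar>\<sigma>\<bar> \<le> 2 \<bar>y\<bar>\<close>, so that the three error terms in the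
  inner parentheses are at most \<open>1/4\<close>, \<open>1/8\<close> and \<open>1/2\<close> of \<open>y \<bullet> y\<close>.\<close>

lemma null_hessian_estimate:
  fixes z y U :: "'e::euclidean_space" and \<sigma> :: real
  assumes "z \<noteq> 0" "y \<noteq> 0"
    and h: "\<And>u v. \<bar>h u v - u \<bullet> v\<bar> \<le> 1/8 * norm u * norm v"
    and Dh: "\<And>u v a. norm z * \<bar>Dh u v a\<bar> \<le> 1/8 * norm u * norm v * norm a"
    and D\<omega>: "\<And>u a. norm z * \<bar>D\<omega> u a - D\<omega> a u\<bar> \<le> 1/8 * norm u * norm a"
    and U: "\<And>w. h U w = z \<bullet> w" and \<sigma>: "\<sigma>\<^sup>2 = h y y"
  shows "- 2 * (y \<bullet> y) + 2 * (Dh y U y - Dh y y U / 2 + \<sigma> * (D\<omega> U y - D\<omega> y U)) < 0"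
proof -
  have z: "norm z > 0" and y: "norm y > 0" using assms(1,2) by auto
  have "norm U \<le> 2 * norm z"
  proof (cases "U = 0")
    case False
    have "7/8 * (norm U * norm U) \<le> h U U"
      using h[of U U] unfolding dot_square_norm power2_eq_square by linarith
    also have "\<dots> \<le> norm z * norm U" using norm_cauchy_schwarz[of z U] by (simp add: U)
    finally have "7/8 * norm U \<le> norm z" using False by (simp add: mult.assoc[symmetric])
    then show ?thesis using norm_ge_zero[of z] by linarith
  qed simp
  then have scale: "k * norm U \<le> 2 * k * norm z" if "k \<ge> 0" for k
    using mult_left_mono[OF _ that, of "norm U" "2 * norm z"] by simp
  have cancel: "a \<le> b" if "norm z * a \<le> norm z * b" for a b
    using that z by simp
  have "\<bar>Dh y U y\<bar> \<le> 1/4 * (norm y)\<^sup>2"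
    using Dh[of y U y] scale[of "1/8 * (norm y)\<^sup>2"]
    by - (rule cancel, simp add: power2_eq_square mult_ac)
  moreover have "\<bar>Dh y y U\<bar> \<le> 1/4 * (norm y)\<^sup>2"
    using Dh[of y y U] scale[of "1/8 * (norm y)\<^sup>2"]
    by - (rule cancel, simp add: power2_eq_square mult_ac)
  moreover have "\<bar>\<sigma> * (D\<omega> U y - D\<omega> y U)\<bar> \<le> 1/2 * (norm y)\<^sup>2"
  proof -
    have "\<sigma>\<^sup>2 \<le> 9/8 * (norm y)\<^sup>2"
      using h[of y y] unfolding \<sigma> dot_square_norm unfolding power2_eq_square by linarith
    also have "\<dots> \<le> (2 * norm y)\<^sup>2" by (simp add: power_mult_distrib)
    finally have "\<bar>\<sigma>\<bar> \<le> 2 * norm y" using power2_le_imp_le[of "\<bar>\<sigma>\<bar>" "2 * norm y"] by simp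
    moreover have "\<bar>D\<omega> U y - D\<omega> y U\<bar> \<le> 1/4 * norm y"
      using D\<omega>[of U y] scale[of "1/8 * norm y"]
      by - (rule cancel, simp add: mult_ac)
    ultimately have "\<bar>\<sigma>\<bar> * \<bar>D\<omega> U y - D\<omega> y U\<bar> \<le> (2 * norm y) * (1/4 * norm y)"
      by (intro mult_mono) auto
    then show ?thesis by (simp add: abs_mult power2_eq_square)
  qed
  moreover have "(norm y)\<^sup>2 > 0" using y by simp
  moreover have "- 2 * n + 2 * (a - b / 2 + s) < 0"
    if "\<bar>a\<bar> \<le> 1/4 * n" "\<bar>b\<bar> \<le> 1/4 * n" "\<bar>s\<bar> \<le> 1/2 * n" "n > 0" for a b s n :: real
    using abs_le_D1[OF that(1)] abs_le_D2[OF that(2)] abs_le_D1[OF that(3)] that(4)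
    by (simp add: field_simps)
  ultimately show ?thesis unfolding dot_square_norm by blast
qed


section \<open>Light-convexity of large spheres\<close>

lemma has_differential_h_metric_omega_form:
  fixes g0 :: "('s::{t2_space, second_countable_topology}, real^'n) bilinear_field"
  assumes st: "standard_stationary A g0 \<omega>0 \<beta>" and cA: "c \<in> A"
    and c: "open_chart c" and x: "x \<in> fst c"
  shows "has_differential c \<beta> x (differential c \<beta> x)"
    and "has_differential c (\<lambda>Q. h_metric g0 \<omega>0 \<beta> c Q u v) x
      (differential c (\<lambda>Q. h_metric g0 \<omega>0 \<beta> c Q u v) x)"
    and "has_differential c (\<lambda>Q. omega_form \<omega>0 \<beta> c Q u) x
      (differential c (\<lambda>Q. omega_form \<omega>0 \<beta> c Q u) x)"
proof -
  have iff: "has_differential c f x (differential c f x) \<longleftrightarrow>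
      in_coords c f differentiable (at (snd c x))" for f :: "'s \<Rightarrow> real"
    unfolding has_differential_def differential_def by (rule frechet_derivative_works[symmetric])
  have "smooth_on (snd c ` fst c) (in_coords c \<beta>)"
    "smooth_on (snd c ` fst c) (in_coords c (\<lambda>P. \<omega>0 c P u))"
    "smooth_on (snd c ` fst c) (in_coords c (\<lambda>P. g0 c P u v))" for u v
    using st cA unfolding standard_stationary_def smooth_function_def one_form_def
      riemannian_metric_def by blast+
  note smooth_on_imp_has_differential[OF c x this(1)] smooth_on_imp_has_differential[OF c x this(2)]
    smooth_on_imp_has_differential[OF c x this(3)]
  then have b: "in_coords c \<beta> differentiable (at (snd c x))"
    and w: "in_coords c (\<lambda>P. \<omega>0 c P u) differentiable (at (snd c x))"
    and g: "in_coords c (\<lambda>P. g0 c P u v) differentiable (at (snd c x))" for u v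
    unfolding iff .
  have b0: "in_coords c \<beta> (snd c x) \<noteq> 0"
    using st in_coords_apply[OF c x, of \<beta>] unfolding standard_stationary_def
    by (metis less_irrefl)
  show "has_differential c \<beta> x (differential c \<beta> x)"
    unfolding iff by (rule b)
  have "in_coords c (\<lambda>Q. h_metric g0 \<omega>0 \<beta> c Q u v) =
      (\<lambda>z. in_coords c (\<lambda>P. \<omega>0 c P u) z * in_coords c (\<lambda>P. \<omega>0 c P v) z / (in_coords c \<beta> z)\<^sup>2 +
        in_coords c (\<lambda>P. g0 c P u v) z / in_coords c \<beta> z)"
    by (simp add: h_metric_def in_coords_def o_def)
  then show "has_differential c (\<lambda>Q. h_metric g0 \<omega>0 \<beta> c Q u v) x
      (differential c (\<lambda>Q. h_metric g0 \<omega>0 \<beta> c Q u v) x)"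
    unfolding iff using b w g b0
    by (auto intro!: differentiable_add differentiable_divide differentiable_mult differentiable_power)
  have "in_coords c (\<lambda>Q. omega_form \<omega>0 \<beta> c Q u) =
      (\<lambda>z. in_coords c (\<lambda>P. \<omega>0 c P u) z / in_coords c \<beta> z)"
    by (simp add: omega_form_def in_coords_def o_def)
  then show "has_differential c (\<lambda>Q. omega_form \<omega>0 \<beta> c Q u) x
      (differential c (\<lambda>Q. omega_form \<omega>0 \<beta> c Q u) x)"
    unfolding iff using b w b0 by (auto intro!: differentiable_divide)
qed

lemma h_metric_omega_form_algebra:
  fixes g0 :: "('s::{t2_space, second_countable_topology}, real^'n) bilinear_field"
  assumes st: "standard_stationary A g0 \<omega>0 \<beta>" and cA: "c \<in> A" and Q: "Q \<in> fst c"
  shows "bilinear (h_metric g0 \<omega>0 \<beta> c Q)"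
    and "h_metric g0 \<omega>0 \<beta> c Q u v = h_metric g0 \<omega>0 \<beta> c Q v u"
    and "u \<noteq> 0 \<Longrightarrow> h_metric g0 \<omega>0 \<beta> c Q u u > 0"
    and "linear (omega_form \<omega>0 \<beta> c Q)"
proof -
  have \<beta>: "\<beta> Q > 0" using st by (simp add: standard_stationary_def)
  have "riemannian_metric A g0" and "one_form A \<omega>0"
    using st by (simp_all add: standard_stationary_def)
  note conjunct1[OF this(1)[unfolded riemannian_metric_def]]
    conjunct1[OF this(2)[unfolded one_form_def]]
  from bspec[OF bspec[OF this(1) cA] Q] bspec[OF bspec[OF this(2) cA] Q]
  have g: "bilinear (g0 c Q)" "\<And>u v. g0 c Q u v = g0 c Q v u"
      "\<And>v. v \<noteq> 0 \<Longrightarrow> g0 c Q v v > 0"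
    and w: "linear (\<omega>0 c Q)"
    by blast+
  note lin = bilinear_ladd[OF g(1)] bilinear_lmul[OF g(1)] bilinear_radd[OF g(1)]
    bilinear_rmul[OF g(1)] linear_add[OF w] linear_scale[OF w]
  show "bilinear (h_metric g0 \<omega>0 \<beta> c Q)"
    unfolding bilinear_def by (intro conjI allI linearI)
      (simp_all add: h_metric_def lin add_divide_distrib distrib_left distrib_right)
  show "linear (omega_form \<omega>0 \<beta> c Q)"
    by (rule linearI) (simp_all add: omega_form_def lin add_divide_distrib)
  show "h_metric g0 \<omega>0 \<beta> c Q u v = h_metric g0 \<omega>0 \<beta> c Q v u"
    by (simp add: h_metric_def g(2)[of u] mult.commute)
  show "h_metric g0 \<omega>0 \<beta> c Q u u > 0" if "u \<noteq> 0"
    unfolding h_metric_def using g(3)[OF that] \<beta> by (intro add_nonneg_pos) auto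
qed

text \<open>The decay conditions enter only through this consequence: outside a large coordinate ball,
  \<open>h - \<delta>\<close>, \<open>\<bar>z\<bar> \<partial>h\<close> and \<open>\<bar>z\<bar> d\<omega>\<close> are small as multilinear forms, where \<open>z\<close> is the coordinate
  vector of the point.\<close>

lemma asymptotic_chart_small:
  fixes h :: "('s::topological_space, real^'n) bilinear_field"
  assumes ac: "asymptotic_chart A h \<omega> E c" and c: "open_chart c"
    and hbil: "\<And>x. x \<in> fst c \<Longrightarrow> bilinear (h c x)"
    and \<omega>lin: "\<And>x. x \<in> fst c \<Longrightarrow> linear (\<omega> c x)"
    and Dh: "\<And>x u v. x \<in> fst c \<Longrightarrow>
      has_differential c (\<lambda>Q. h c Q u v) x (differential c (\<lambda>Q. h c Q u v) x)"
    and D\<omega>: "\<And>x u. x \<in> fst c \<Longrightarrow>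
      has_differential c (\<lambda>Q. \<omega> c Q u) x (differential c (\<lambda>Q. \<omega> c Q u) x)"
  shows "\<exists>R. \<forall>x\<in>fst c. norm (snd c x) > R \<longrightarrow>
    (\<forall>u v. \<bar>h c x u v - u \<bullet> v\<bar> \<le> 1/8 * norm u * norm v) \<and>
    (\<forall>u v a. norm (snd c x) * \<bar>differential c (\<lambda>Q. h c Q u v) x a\<bar>
        \<le> 1/8 * norm u * norm v * norm a) \<and>
    (\<forall>u a. norm (snd c x) * \<bar>differential c (\<lambda>Q. \<omega> c Q u) x a - differential c (\<lambda>Q. \<omega> c Q a) x u\<bar>
        \<le> 1/8 * norm u * norm a)"
proof -
  define N where "N = real CARD('n)"
  \<comment> \<open>A trilinear form whose components are at most \<open>e\<close> has norm at most \<open>N\<^sup>3 e = 1/8\<close>.\<close>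
  define e where "e = 1 / (8 * N ^ 3)"
  have N: "N \<ge> 1" unfolding N_def by (simp add: Suc_leI)
  have e: "e > 0" "N ^ 3 * e = 1/8" using N by (auto simp: e_def)
  have e2: "N\<^sup>2 * e \<le> 1/8"
    using N by (simp add: e_def field_simps power2_eq_square power3_eq_cube)
  have app: "in_coords c f (snd c x) = f x" if "x \<in> fst c" for f :: "'s \<Rightarrow> real" and x
    by (rule in_coords_apply[OF c that])
  obtain p q where "p > 0" "q > 0" and as:
    "\<And>i j. in_coords c (\<lambda>x. h c x (axis i 1) (axis j 1) - (if i = j then 1 else 0))
       \<in> O[at_infinity](\<lambda>z. 1 / norm z powr p)"
    "\<And>i j k. in_coords c (\<lambda>x. differential c (\<lambda>x'. h c x' (axis i 1) (axis j 1)) x (axis k 1))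
       \<in> O[at_infinity](\<lambda>z. 1 / norm z powr (p + 1))"
    "\<And>i j. in_coords c (\<lambda>x. differential c (\<lambda>x'. \<omega> c x' (axis j 1)) x (axis i 1)
         - differential c (\<lambda>x'. \<omega> c x' (axis i 1)) x (axis j 1))
       \<in> O[at_infinity](\<lambda>z. 1 / norm z powr (q + 1))"
    using ac unfolding asymptotic_chart_def by blast
  have "\<forall>\<^sub>F z in at_infinity. \<forall>i j.
      \<bar>in_coords c (\<lambda>x. h c x (axis i 1) (axis j 1) - (if i = j then 1 else 0)) z\<bar> \<le> e"
    by (intro eventually_all_finite eventually_small_of_bigo[OF as(1)] \<open>p > 0\<close> e(1))
  moreover have "\<forall>\<^sub>F z in at_infinity. \<forall>i j k. norm z *
      \<bar>in_coords c (\<lambda>x. differential c (\<lambda>x'. h c x' (axis i 1) (axis j 1)) x (axis k 1)) z\<bar> \<le> e"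
    by (intro eventually_all_finite eventually_norm_times_small_of_bigo[OF as(2)] \<open>p > 0\<close> e(1))
  moreover have "\<forall>\<^sub>F z in at_infinity. \<forall>i j. norm z *
      \<bar>in_coords c (\<lambda>x. differential c (\<lambda>x'. \<omega> c x' (axis j 1)) x (axis i 1)
         - differential c (\<lambda>x'. \<omega> c x' (axis i 1)) x (axis j 1)) z\<bar> \<le> e"
    by (intro eventually_all_finite eventually_norm_times_small_of_bigo[OF as(3)] \<open>q > 0\<close> e(1))
  ultimately have "\<forall>\<^sub>F z in at_infinity. \<forall>i j k.
      \<bar>in_coords c (\<lambda>x. h c x (axis i 1) (axis j 1) - (if i = j then 1 else 0)) z\<bar> \<le> e \<and>
      norm z *
      \<bar>in_coords c (\<lambda>x. differential c (\<lambda>x'. h c x' (axis i 1) (axis j 1)) x (axis k 1)) z\<bar> \<le> e \<and>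
      norm z * \<bar>in_coords c (\<lambda>x. differential c (\<lambda>x'. \<omega> c x' (axis j 1)) x (axis i 1)
         - differential c (\<lambda>x'. \<omega> c x' (axis i 1)) x (axis j 1)) z\<bar> \<le> e"
    by eventually_elim blast
  then obtain R where R: "\<And>z i j k. norm z \<ge> R \<Longrightarrow>
      \<bar>in_coords c (\<lambda>x. h c x (axis i 1) (axis j 1) - (if i = j then 1 else 0)) z\<bar> \<le> e \<and>
      norm z *
      \<bar>in_coords c (\<lambda>x. differential c (\<lambda>x'. h c x' (axis i 1) (axis j 1)) x (axis k 1)) z\<bar> \<le> e \<and>
      norm z * \<bar>in_coords c (\<lambda>x. differential c (\<lambda>x'. \<omega> c x' (axis j 1)) x (axis i 1)
         - differential c (\<lambda>x'. \<omega> c x' (axis i 1)) x (axis j 1)) z\<bar> \<le> e"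
    unfolding eventually_at_infinity by blast
  show ?thesis
  proof (intro exI[of _ R] ballI impI conjI allI)
    fix x u v a assume x: "x \<in> fst c" and "norm (snd c x) > R"
    then have b:
      "\<bar>h c x (axis i 1) (axis j 1) - (if i = j then 1 else 0)\<bar> \<le> e"
      "norm (snd c x) * \<bar>differential c (\<lambda>Q. h c Q (axis i 1) (axis j 1)) x (axis k 1)\<bar> \<le> e"
      "norm (snd c x) * \<bar>differential c (\<lambda>Q. \<omega> c Q (axis j 1)) x (axis i 1)
         - differential c (\<lambda>Q. \<omega> c Q (axis i 1)) x (axis j 1)\<bar> \<le> e" for i j k
      using R[of "snd c x" i j k] by (simp_all add: app)
    have le: "N\<^sup>2 * e * norm u * norm v \<le> 1/8 * norm u * norm v" for u v :: "real^'n"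
      using e2 by (intro mult_right_mono) auto

    note hl = bilinear_ladd[OF hbil[OF x]] bilinear_lmul[OF hbil[OF x]]
      bilinear_radd[OF hbil[OF x]] bilinear_rmul[OF hbil[OF x]]
    have "bilinear (\<lambda>u v. h c x u v - u \<bullet> v)"
      unfolding bilinear_def
      by (intro conjI allI linearI) (simp_all add: hl inner_left_distrib inner_right_distrib algebra_simps)
    then have "\<bar>h c x u v - u \<bullet> v\<bar> \<le> N\<^sup>2 * e * norm u * norm v"
      unfolding N_def
    proof (rule bilinear_bound_axis)
      fix i j :: 'n
      show "\<bar>h c x (axis i 1) (axis j 1) - axis i 1 \<bullet> axis j (1::real)\<bar> \<le> e"
        using b(1)[of i j] by (cases "i = j") (simp_all add: inner_axis_axis)
    qed
    then show "\<bar>h c x u v - u \<bullet> v\<bar> \<le> 1/8 * norm u * norm v"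
      using le[of u v] by (rule order_trans)

    have Dhbil: "bilinear (\<lambda>u v. differential c (\<lambda>Q. h c Q u v) x w)" for w
      by (rule differential_bilinear[where f = "h c" and
            D = "\<lambda>u v. differential c (\<lambda>Q. h c Q u v) x", OF c x hbil Dh[OF x]])
    have Dhlin: "linear (differential c (\<lambda>Q. h c Q u v) x)" for u v
      by (rule has_differential_linear[OF Dh[OF x]])
    have *: "\<bar>norm (snd c x) * differential c (\<lambda>Q. h c Q u v) x (axis k 1)\<bar>
        \<le> N\<^sup>2 * e * norm u * norm v" for k
      unfolding N_def
    proof (rule bilinear_bound_axis)
      show "bilinear (\<lambda>u v. norm (snd c x) * differential c (\<lambda>Q. h c Q u v) x (axis k 1))"
        unfolding bilinear_def
        by (intro conjI allI linearI)
          (simp_all add: bilinear_ladd[OF Dhbil] bilinear_lmul[OF Dhbil] bilinear_radd[OF Dhbil]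
            bilinear_rmul[OF Dhbil] distrib_left)
    qed (use b(2) in \<open>simp add: abs_mult\<close>)
    have "\<bar>norm (snd c x) * differential c (\<lambda>Q. h c Q u v) x a\<bar>
        \<le> N * (N\<^sup>2 * e * norm u * norm v) * norm a"
      unfolding N_def
    proof (rule linear_bound_axis)
      show "linear (\<lambda>a. norm (snd c x) * differential c (\<lambda>Q. h c Q u v) x a)"
        by (rule linearI) (simp_all add: linear_add[OF Dhlin] linear_scale[OF Dhlin] distrib_left)
    qed (rule *[unfolded N_def])
    also have "\<dots> = (N ^ 3 * e) * norm u * norm v * norm a"
      by (simp add: power3_eq_cube power2_eq_square)
    finally show "norm (snd c x) * \<bar>differential c (\<lambda>Q. h c Q u v) x a\<bar>
        \<le> 1/8 * norm u * norm v * norm a"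
      unfolding e(2) by (simp add: abs_mult)

    have D\<omega>1: "linear (\<lambda>u. differential c (\<lambda>Q. \<omega> c Q u) x w)" for w
      by (rule differential_linear[where f = "\<omega> c" and
            D = "\<lambda>u. differential c (\<lambda>Q. \<omega> c Q u) x", OF c x \<omega>lin D\<omega>[OF x]])
    have D\<omega>2: "linear (differential c (\<lambda>Q. \<omega> c Q u) x)" for u
      by (rule has_differential_linear[OF D\<omega>[OF x]])
    have "\<bar>norm (snd c x) *
        (differential c (\<lambda>Q. \<omega> c Q u) x a - differential c (\<lambda>Q. \<omega> c Q a) x u)\<bar>
        \<le> N\<^sup>2 * e * norm u * norm a"
      unfolding N_def
    proof (rule bilinear_bound_axis)
      show "bilinear (\<lambda>u a. norm (snd c x) *
          (differential c (\<lambda>Q. \<omega> c Q u) x a - differential c (\<lambda>Q. \<omega> c Q a) x u))"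
        unfolding bilinear_def
        by (intro conjI allI linearI)
          (simp_all add: linear_add[OF D\<omega>1] linear_scale[OF D\<omega>1] linear_add[OF D\<omega>2]
            linear_scale[OF D\<omega>2] algebra_simps)
      show "\<bar>norm (snd c x) * (differential c (\<lambda>Q. \<omega> c Q (axis i 1)) x (axis j 1) -
          differential c (\<lambda>Q. \<omega> c Q (axis j 1)) x (axis i 1))\<bar> \<le> e" for i j
        using b(3)[of i j] by (simp add: abs_mult)
    qed
    then have "\<bar>norm (snd c x) *
        (differential c (\<lambda>Q. \<omega> c Q u) x a - differential c (\<lambda>Q. \<omega> c Q a) x u)\<bar>
        \<le> 1/8 * norm u * norm a"
      using le[of u a] by (rule order_trans)
    then show "norm (snd c x) *
        \<bar>differential c (\<lambda>Q. \<omega> c Q u) x a - differential c (\<lambda>Q. \<omega> c Q a) x u\<bar>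
        \<le> 1/8 * norm u * norm a"
      by (simp add: abs_mult)
  qed
qed

lemma asymptotic_chart_light_convex:
  fixes g0 :: "('s::{t2_space, second_countable_topology}, real^'n) bilinear_field"
  assumes st: "standard_stationary A g0 \<omega>0 \<beta>"
    and ac: "asymptotic_chart A (h_metric g0 \<omega>0 \<beta>) (omega_form \<omega>0 \<beta>) E c"
  shows "\<exists>R. \<forall>r0>R. sphere 0 r0 \<subseteq> snd c ` fst c \<and>
    strongly_light_convex (time_chart c) (stationary_metric g0 \<omega>0 \<beta> c) (sphere_function c r0)"
proof -
  let ?h = "h_metric g0 \<omega>0 \<beta> c" and ?\<omega> = "omega_form \<omega>0 \<beta> c"
  have cA: "c \<in> A" using ac by (simp add: asymptotic_chart_def)
  then have c: "open_chart c"
    using st unfolding standard_stationary_def smooth_manifold_def is_chart_def open_chart_def by blast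
  have \<beta>: "\<And>x. \<beta> x > 0" using st by (simp add: standard_stationary_def)
  note comp = h_metric_omega_form_algebra[OF st cA]
    and diff = has_differential_h_metric_omega_form[OF st cA c]
  obtain R1 where R1: "{z. norm z > R1} \<subseteq> snd c ` fst c"
    using ac unfolding asymptotic_chart_def by blast
  obtain R2 where R2: "\<forall>x\<in>fst c. norm (snd c x) > R2 \<longrightarrow>
    (\<forall>u v. \<bar>?h x u v - u \<bullet> v\<bar> \<le> 1/8 * norm u * norm v) \<and>
    (\<forall>u v a. norm (snd c x) * \<bar>differential c (\<lambda>Q. ?h Q u v) x a\<bar>
        \<le> 1/8 * norm u * norm v * norm a) \<and>
    (\<forall>u a. norm (snd c x) * \<bar>differential c (\<lambda>Q. ?\<omega> Q u) x a - differential c (\<lambda>Q. ?\<omega> Q a) x u\<bar>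
        \<le> 1/8 * norm u * norm a)"
    using asymptotic_chart_small[OF ac c comp(1,4) diff(2,3)] by blast
  have "hessian (time_chart c) (stationary_metric g0 \<omega>0 \<beta> c) (sphere_function c r0) P v v < 0"
    if r0: "r0 > max 0 R2" and P: "P \<in> fst (time_chart c)" "sphere_function c r0 P = 0"
      and null: "lightlike (stationary_metric g0 \<omega>0 \<beta> c P) v"
      and tan: "differential (time_chart c) (sphere_function c r0) P v = 0" for r0 P v
  proof -
    obtain x t y \<tau> where [simp]: "P = (x, t)" "v = (y, \<tau>)" by fastforce
    have x: "x \<in> fst c" using P(1) by (simp add: time_chart_def)
    have "norm (snd c x) = r0"
      using P(2) r0 by (simp add: sphere_function_def power2_eq_iff_nonneg)
    then have nz: "snd c x \<noteq> 0" and large: "norm (snd c x) > R2" using r0 by auto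
    have tangent: "snd c x \<bullet> y = 0"
      using tan unfolding differential_sphere_function[OF c P(1)] by simp
    have g: "stationary_metric g0 \<omega>0 \<beta> c (x, t) (y, \<tau>) (y, \<tau>) = 0" and "(y, \<tau>) \<noteq> 0"
      using null by (simp_all add: lightlike_def)
    then have \<sigma>: "(\<tau> - ?\<omega> x y)\<^sup>2 = ?h x y y"
      using \<beta>[of x] by (simp add: stationary_metric_conformal[OF \<beta>] power2_eq_square)
    have "y \<noteq> 0"
    proof
      assume "y = 0"
      then have "\<tau> = 0"
        using \<sigma> bilinear_rzero[OF comp(1)[OF x]] linear_0[OF comp(4)[OF x]] by simp
      with \<open>y = 0\<close> \<open>(y, \<tau>) \<noteq> 0\<close> show False by (simp add: zero_prod_def)
    qed
    have "\<exists>U. \<forall>w. ?h x U w = snd c x \<bullet> w"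
    proof (rule nondegenerate_representation[OF comp(1)[OF x]])
      show "u = 0" if "\<And>w. ?h x u w = 0" for u
        using that[of u] comp(3)[OF x, of u] by force
    qed (auto intro!: linearI simp: inner_right_distrib)
    then obtain U where U: "\<And>w. ?h x U w = snd c x \<bullet> w" by blast
    note hess = hessian_sphere_function[OF stationary_metric_conformal[OF \<beta>] c x \<beta>
        comp(1,2) comp(3)[OF x] comp(4) diff[OF x] g tangent U]
    show ?thesis
      using null_hessian_estimate[OF nz \<open>y \<noteq> 0\<close> _ _ _ U \<sigma>,
          of "\<lambda>u v. differential c (\<lambda>Q. ?h Q u v) x" "\<lambda>u. differential c (\<lambda>Q. ?\<omega> Q u) x"]
        R2[rule_format, OF x large]
      by (simp add: hess)
  qed
  then have "strongly_light_convex (time_chart c) (stationary_metric g0 \<omega>0 \<beta> c) (sphere_function c r0)"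
    if "r0 > max 0 R2" for r0
    using that unfolding strongly_light_convex_def by blast
  moreover have "sphere 0 r0 \<subseteq> snd c ` fst c" if "r0 > R1" for r0
    using that R1 by auto
  ultimately show ?thesis
    by (intro exI[of _ "max R1 (max 0 R2)"]) simp
qed

theorem corollary4p4:
  fixes A :: "('s::{t2_space, second_countable_topology}, real^'n) chart set"
    and g0 :: "('s, real^'n) bilinear_field"
    and \<omega>0 :: "('s, real^'n) covector_field"
    and \<beta> :: "'s \<Rightarrow> real"
    and K :: "'s set" and m :: nat and E :: "nat \<Rightarrow> 's set"
    and X :: "nat \<Rightarrow> ('s, real^'n) chart"
  assumes "standard_stationary A g0 \<omega>0 \<beta>"
    and "geodesically_conformally_asymptotically_flat A g0 \<omega>0 \<beta> K m E X"
  shows "\<exists>R>0. \<forall>k\<in>{1..m}. \<forall>r0>R.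
           sphere 0 r0 \<subseteq> snd (X k) ` fst (X k) \<and>
           strongly_light_convex (time_chart (X k)) (stationary_metric g0 \<omega>0 \<beta> (X k))
             (sphere_function (X k) r0)"
proof -
  have "\<forall>k\<in>{1..m}. \<exists>R. \<forall>r0>R. sphere 0 r0 \<subseteq> snd (X k) ` fst (X k) \<and>
      strongly_light_convex (time_chart (X k)) (stationary_metric g0 \<omega>0 \<beta> (X k))
        (sphere_function (X k) r0)"
  proof
    fix k assume "k \<in> {1..m}"
    then have "asymptotic_chart A (h_metric g0 \<omega>0 \<beta>) (omega_form \<omega>0 \<beta>) (E k) (X k)"
      using assms(2) unfolding geodesically_conformally_asymptotically_flat_def by blast
    from asymptotic_chart_light_convex[OF assms(1) this]
    show "\<exists>R. \<forall>r0>R. sphere 0 r0 \<subseteq> snd (X k) ` fst (X k) \<and>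
      strongly_light_convex (time_chart (X k)) (stationary_metric g0 \<omega>0 \<beta> (X k))
        (sphere_function (X k) r0)" .
  qed
  then obtain R where R: "\<forall>k\<in>{1..m}. \<forall>r0>R k. sphere 0 r0 \<subseteq> snd (X k) ` fst (X k) \<and>
      strongly_light_convex (time_chart (X k)) (stationary_metric g0 \<omega>0 \<beta> (X k))
        (sphere_function (X k) r0)"
    unfolding bchoice_iff by blast
  show ?thesis
  proof (intro exI[of _ "1 + (\<Sum>k\<in>{1..m}. \<bar>R k\<bar>)"] conjI ballI allI impI)
    show "0 < 1 + (\<Sum>k\<in>{1..m}. \<bar>R k\<bar>)" by (simp add: add_pos_nonneg sum_nonneg)
    fix k r0 assume k: "k \<in> {1..m}" and "r0 > 1 + (\<Sum>k\<in>{1..m}. \<bar>R k\<bar>)"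
    moreover have "R k \<le> (\<Sum>k\<in>{1..m}. \<bar>R k\<bar>)"
      using member_le_sum[OF k, of "\<lambda>k. \<bar>R k\<bar>"] by simp
    ultimately have "r0 > R k" by simp
    with R k show "sphere 0 r0 \<subseteq> snd (X k) ` fst (X k)"
      "strongly_light_convex (time_chart (X k)) (stationary_metric g0 \<omega>0 \<beta> (X k))
        (sphere_function (X k) r0)"
      by blast+
  qed
qed

end
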